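(* For any acyclic digraph $D$ with $d$ vertices, $$\Xi_D=\sum_{\pi\in\Pi_d}\mu(\hat0,\pi)\,T^D_{\ge\pi}.$$
   Context: A digraph is a finite labelled directed graph without multiple edges, possibly with loops; acyclic means having no directed cycles (in particular no loops). A digraph $D$ with $d$ vertices, taken to be $[d]=\{1,\dots,d\}$, is identified with its associated board $B=E(D)\subset[d]\times[d]$ (edge $(i,j)$ corresponds to the square in row $i$, column $j$). $\Pi_d$ is the lattice of set partitions of $[d]$ ordered by refinement, $\hat0$ is its minimum element (all blocks singletons), and $\mu$ is its Möbius function. Path-cycle symmetric function: a path-cycle cover of $D$ is a subset $S$ of edges no two of which lie in the same row or column of the board, i.e. the spanning subgraph with edge set $S$ is a vertex-disjoint union of directed paths and directed cycles (isolated vertices are directed paths). $\pi(S)$ and $\sigma(S)$ are the sets of vertex sets of its paths and cycles respectively. With $x,y$ two countably infinite sets of commuting indeterminates, and $\tilde m_\lambda=(r_1!r_2!\cdots)m_\lambda$ where $r_i$ is the number of parts of $\lambda$ equal to $i$, $\Xi_D=\sum_S\tilde m_{\pi(S)}(x)p_{\sigma(S)}(y)$, the sum over all path-cycle covers $S$ of $D$ (set partitions in subscripts stand for their types). For acyclic $D$ there are no cycles, so $\Xi_D$ involves only the $x$ variables. Definition of $T^D_{\ge\pi}$: extend the columns of $[d]\times[d]$ infinitely downwards, appending infinitely many rows (the $1$st, $2$nd, $\dots$ appended rows, each with $d$ squares). Let $\mathcal S$ be the set of all placements of $d$ rooks such that (1) every rook lies either on $B$ or on one of the appended squares, and (2)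 no two rooks lie in the same column (so each column has exactly one rook). For $S\in\mathcal S$, let $\pi(S)$ be the partition of $[d]$ in which $i$ and $j$ are in the same block if and only if the rooks in columns $i$ and $j$ lie in the same row. Associate to $S$ a coloring $c_S$ of $[d]$: vertex $i$ gets color $j$ if the rook in column $i$ lies in the $j$th appended row; otherwise, if the rook in column $i$ lies in the $j$th original row, vertex $i$ gets the same color as vertex $j$ (this is well defined since $D$ is acyclic). Put $x^S=\prod_{i\in[d]}x_{c_S(i)}$, and for set partitions $\pi$ of $[d]$ put $$T^D_\pi=\sum_{\{S\in\mathcal S\,\mid\,\pi(S)=\pi\}}x^S,\qquad T^D_{\ge\pi}=\sum_{\sigma\ge\pi}T^D_\sigma .$$ *)

theory Defs
  imports Complex_Main "HOL-Library.Multiset" "HOL-Library.Disjoint_Sets"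
begin

section \<open>Formal power series in arbitrarily many indeterminates\<close>

text \<open>
  A monomial in the commuting indeterminates of type \<open>'v\<close> is a finite multiset of indeterminates;
  a formal power series over the integers assigns a coefficient to every monomial.
\<close>

typedef 'v series = "UNIV :: ('v multiset \<Rightarrow> int) set"
  morphisms coeff Series by simp

lemma coeff_Series [simp]: "coeff (Series f) = f"
  by (simp add: Series_inverse)

lemma series_eqI: "(\<And>M. coeff f M = coeff g M) \<Longrightarrow> f = g"
  by (simp add: coeff_inject [symmetric] fun_eq_iff)

definition splits :: "'v multiset \<Rightarrow> ('v multiset \<times> 'v multiset) set" where
  "splits M = {(A, B). A + B = M}"

lemma finite_splits [simp]: "finite (splits (M :: 'v multiset))"
proof (induction M)
  case empty
  have "splits {#} = {({#}, {#}) :: 'v multiset \<times> 'v multiset}" by (auto simp: splits_def)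
  then show ?case by simp
next
  case (add x M)
  have "splits (add_mset x M) \<subseteq>
      (\<lambda>(A, B). (add_mset x A, B)) ` splits M \<union> (\<lambda>(A, B). (A, add_mset x B)) ` splits M"
  proof safe
    fix A B assume *: "(A, B) \<in> splits (add_mset x M)"
      "(A, B) \<notin> (\<lambda>(A, B). (A, add_mset x B)) ` splits M"
    then have eq: "A + B = add_mset x M" by (simp add: splits_def)
    then have "x \<in># A + B" by simp
    then consider "x \<in># A" | "x \<in># B" by auto
    then show "(A, B) \<in> (\<lambda>(A, B). (add_mset x A, B)) ` splits M"
    proof cases
      case 1
      then obtain A' where "A = add_mset x A'" by (meson mset_add)
      with eq show ?thesis by (auto simp: splits_def image_iff)
    next
      case 2
      then obtain B' where "B = add_mset x B'" by (meson mset_add)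
      with eq * show ?thesis by (auto simp: splits_def image_iff)
    qed
  qed
  then show ?case by (rule finite_subset) (simp add: add)
qed

instantiation series :: (type) comm_ring_1
begin

definition "0 = Series (\<lambda>_. 0)"
definition "1 = Series (\<lambda>M. if M = {#} then 1 else 0)"
definition "f + g = Series (\<lambda>M. coeff f M + coeff g M)"
definition "f - g = Series (\<lambda>M. coeff f M - coeff g M)"
definition "- f = Series (\<lambda>M. - coeff f M)"
definition "f * g = Series (\<lambda>M. \<Sum>(A, B)\<in>splits M. coeff f A * coeff g B)"

instance
proof
  fix f g h :: "'a series"
  show "f * g * h = f * (g * h)"
  proof (rule series_eqI)
    fix M
    have "coeff (f * g * h) M =
        (\<Sum>(P, C)\<in>splits M. \<Sum>(A, B)\<in>splits P. coeff f A * coeff g B * coeff h C)"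
      by (simp add: times_series_def sum_distrib_right case_prod_unfold)
    also have "\<dots> = (\<Sum>((P, C), (A, B))\<in>(SIGMA p:splits M. splits (fst p)).
        coeff f A * coeff g B * coeff h C)"
      by (subst sum.Sigma [symmetric]) (auto simp: case_prod_unfold)
    also have "\<dots> = (\<Sum>((A, P), (B, C))\<in>(SIGMA p:splits M. splits (snd p)).
        coeff f A * coeff g B * coeff h C)"
      by (rule sum.reindex_bij_witness
            [where i = "\<lambda>((A, P), (B, C)). ((A + B, C), (A, B))"
               and j = "\<lambda>((P, C), (A, B)). ((A, B + C), (B, C))"])
         (auto simp: splits_def add.assoc)
    also have "\<dots> =
        (\<Sum>(A, P)\<in>splits M. \<Sum>(B, C)\<in>splits P. coeff f A * coeff g B * coeff h C)"
      by (subst sum.Sigma [symmetric]) (auto simp: case_prod_unfold)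
    also have "\<dots> = coeff (f * (g * h)) M"
      by (simp add: times_series_def sum_distrib_left case_prod_unfold mult.assoc)
    finally show "coeff (f * g * h) M = coeff (f * (g * h)) M" .
  qed
  show "f * g = g * f"
  proof (rule series_eqI)
    fix M
    show "coeff (f * g) M = coeff (g * f) M"
      unfolding times_series_def coeff_Series
      by (rule sum.reindex_bij_witness [where i = prod.swap and j = prod.swap])
         (auto simp: splits_def add.commute)
  qed
  show "1 * f = f"
  proof (rule series_eqI)
    fix M :: "'a multiset"
    have mem: "({#}, M) \<in> splits M"
      by (simp add: splits_def)
    have "coeff (1 * f) M = (\<Sum>p\<in>splits M. if p = ({#}, M) then coeff f M else 0)"
      unfolding times_series_def one_series_def coeff_Series
      by (rule sum.cong) (auto simp: splits_def split: if_splits)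
    also have "\<dots> = coeff f M"
      using mem by simp
    finally show "coeff (1 * f) M = coeff f M" .
  qed
  show "(0 :: 'a series) \<noteq> 1"
  proof
    assume "(0 :: 'a series) = 1"
    then have "coeff (0 :: 'a series) {#} = coeff 1 {#}" by simp
    then show False by (simp add: zero_series_def one_series_def)
  qed
  show "(f + g) * h = f * h + g * h"
    by (rule series_eqI)
       (simp add: times_series_def plus_series_def case_prod_unfold distrib_right sum.distrib)
qed (auto intro!: series_eqI
       simp: zero_series_def plus_series_def minus_series_def uminus_series_def)

end

definition monom :: "'v multiset \<Rightarrow> 'v series" where
  "monom M = Series (\<lambda>N. if N = M then 1 else 0)"

definition indet :: "'v \<Rightarrow> 'v series" where
  "indet v = monom {#v#}"

text \<open>
  Possibly infinite sums of power series, taken coefficientwise. This is meaningful only for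
  summable families, in which each monomial has a nonzero coefficient in just finitely many
  members; all infinite families below are of this kind.
\<close>

definition formal_sum :: "('i \<Rightarrow> 'v series) \<Rightarrow> 'i set \<Rightarrow> 'v series" where
  "formal_sum f I = Series (\<lambda>M. \<Sum>i | i \<in> I \<and> coeff (f i) M \<noteq> 0. coeff (f i) M)"


section \<open>Symmetric functions\<close>

text \<open>
  The two alphabets are \<open>X 0, X 1, \<dots>\<close> and \<open>Y 0, Y 1, \<dots>\<close>. The argument \<open>v\<close> below is an
  (injective) enumeration of one alphabet, so that \<open>v = X\<close> gives a symmetric function of the \<open>x\<close>
  variables and \<open>v = Y\<close> one of the \<open>y\<close> variables. An integer partition is the multiset of its parts.
\<close>

datatype var = X nat | Y nat

definition exponents :: "'v multiset \<Rightarrow> nat multiset" where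
  "exponents M = image_mset (count M) (mset_set (set_mset M))"

definition monomial_sym :: "(nat \<Rightarrow> 'v) \<Rightarrow> nat multiset \<Rightarrow> 'v series" where
  "monomial_sym v l = formal_sum monom {M. set_mset M \<subseteq> range v \<and> exponents M = l}"

definition aug_monomial_sym :: "(nat \<Rightarrow> 'v) \<Rightarrow> nat multiset \<Rightarrow> 'v series" where
  "aug_monomial_sym v l = of_nat (\<Prod>i\<in>set_mset l. fact (count l i)) * monomial_sym v l"

definition power_sum_sym :: "(nat \<Rightarrow> 'v) \<Rightarrow> nat multiset \<Rightarrow> 'v series" where
  "power_sum_sym v l = (\<Prod>n\<in>#l. formal_sum (\<lambda>j. indet (v j) ^ n) UNIV)"

text \<open>The type of a set partition, or more generally of a finite family of disjoint finite sets.\<close>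

definition partition_type :: "nat set set \<Rightarrow> nat multiset" where
  "partition_type P = image_mset card (mset_set P)"


section \<open>The path-cycle symmetric function\<close>

text \<open>
  A digraph on the vertices \<open>{1..d}\<close> is given by its edge set \<open>E \<subseteq> {1..d} \<times> {1..d}\<close>. The edge
  \<open>(i, j)\<close> is the square in row \<open>i\<close> and column \<open>j\<close>.
\<close>

definition path_cycle_covers :: "(nat \<times> nat) set \<Rightarrow> (nat \<times> nat) set set" where
  "path_cycle_covers E = {S. S \<subseteq> E \<and> inj_on fst S \<and> inj_on snd S}"

text \<open>
  For a list \<open>vs = [v\<^sub>1, \<dots>, v\<^sub>k]\<close> of distinct vertices, the edges \<open>(v\<^sub>i, v\<^sub>i\<^sub>+\<^sub>1)\<close> and, for the
  cycle, additionally \<open>(v\<^sub>k, v\<^sub>1)\<close>, which is a loop if \<open>k = 1\<close>.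
\<close>

definition path_edges :: "'a list \<Rightarrow> ('a \<times> 'a) set" where
  "path_edges vs = set (zip vs (tl vs))"

definition cycle_edges :: "'a list \<Rightarrow> ('a \<times> 'a) set" where
  "cycle_edges vs = set (zip vs (rotate1 vs))"

definition incident_edges :: "('a \<times> 'a) set \<Rightarrow> 'a set \<Rightarrow> ('a \<times> 'a) set" where
  "incident_edges S V = {(i, j) \<in> S. i \<in> V \<or> j \<in> V}"

text \<open>
  Requiring that the edges of \<open>S\<close> incident with the vertex set are exactly those of the path (cycle)
  says that this path (cycle) is an entire connected component of the spanning subgraph
  \<open>({1..d}, S)\<close>. Isolated vertices are the paths with a single vertex.
\<close>

definition cover_paths :: "nat \<Rightarrow> (nat \<times> nat) set \<Rightarrow> nat set set" where
  "cover_paths d S = {set vs | vs. vs \<noteq> [] \<and> distinct vs \<and> set vs \<subseteq> {1..d} \<and>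
     incident_edges S (set vs) = path_edges vs}"

definition cover_cycles :: "nat \<Rightarrow> (nat \<times> nat) set \<Rightarrow> nat set set" where
  "cover_cycles d S = {set vs | vs. vs \<noteq> [] \<and> distinct vs \<and> set vs \<subseteq> {1..d} \<and>
     incident_edges S (set vs) = cycle_edges vs}"

definition path_cycle_sf :: "nat \<Rightarrow> (nat \<times> nat) set \<Rightarrow> var series" where
  "path_cycle_sf d E = (\<Sum>S\<in>path_cycle_covers E.
     aug_monomial_sym X (partition_type (cover_paths d S)) *
     power_sum_sym Y (partition_type (cover_cycles d S)))"


section \<open>The Moebius function of the partition lattice\<close>

text \<open>
  The lattice of partitions of \<open>A\<close> consists of the \<open>P\<close> with \<^term>\<open>partition_on A P\<close>, and
  \<^term>\<open>refines A P Q\<close> is its order relation \<open>P \<le> Q\<close>. The function below is meaningful for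
  finite \<open>A\<close>.
\<close>

function partition_moebius :: "'a set \<Rightarrow> 'a set set \<Rightarrow> 'a set set \<Rightarrow> int" where
  "partition_moebius A P Q =
    (if \<not> finite A \<or> \<not> refines A P Q then 0
     else if P = Q then 1
     else - (\<Sum>R | refines A P R \<and> refines A R Q \<and> R \<noteq> Q. partition_moebius A P R))"
  by pat_completeness auto
termination
proof (relation "measure (\<lambda>(A, P, Q). card {R. refines A P R \<and> refines A R Q})", goal_cases)
  case 1
  then show ?case by simp
next
  case (2 A P Q R)
  have "{R. refines A P R \<and> refines A R Q} \<subseteq> {R. partition_on A R}"
    by (auto simp: refines_def)
  then have "finite {R. refines A P R \<and> refines A R Q}"
    using 2 finitely_many_partition_on finite_subset by blast
  moreover have "{S. refines A P S \<and> refines A S R} \<subset> {S. refines A P S \<and> refines A S Q}"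
  proof
    show "{S. refines A P S \<and> refines A S R} \<subseteq> {S. refines A P S \<and> refines A S Q}"
      using 2 by (auto intro: refines_trans)
    have "refines A Q Q" using 2 by (auto simp: refines_def)
    moreover have "\<not> refines A Q R" using 2 by (auto dest: refines_asym)
    ultimately show "{S. refines A P S \<and> refines A S R} \<noteq> {S. refines A P S \<and> refines A S Q}"
      using 2 by blast
  qed
  ultimately show ?case by (simp add: psubset_card_mono)
qed

declare partition_moebius.simps [simp del]

definition singletons :: "'a set \<Rightarrow> 'a set set" where
  "singletons A = (\<lambda>a. {a}) ` A"


section \<open>Rook placements on the extended board\<close>

text \<open>
  The columns of the board are indexed by \<open>{1..d}\<close>. The appended rows are numbered
  \<open>Appended 0, Appended 1, \<dots>\<close>, so that colors, like the indices of the variables, start at \<open>0\<close>.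
\<close>

datatype row = Original nat | Appended nat

definition extended_board :: "nat \<Rightarrow> (nat \<times> nat) set \<Rightarrow> (row \<times> nat) set" where
  "extended_board d E =
    {(Original i, j) | i j. (i, j) \<in> E} \<union> {(Appended k, j) | k j. j \<in> {1..d}}"

definition placements :: "nat \<Rightarrow> (nat \<times> nat) set \<Rightarrow> (row \<times> nat) set set" where
  "placements d E = {S. S \<subseteq> extended_board d E \<and> finite S \<and> card S = d \<and> inj_on snd S}"

definition row_partition :: "nat \<Rightarrow> (row \<times> nat) set \<Rightarrow> nat set set" where
  "row_partition d S = {1..d} //
     {(i, j). i \<in> {1..d} \<and> j \<in> {1..d} \<and> (\<exists>r. (r, i) \<in> S \<and> (r, j) \<in> S)}"

inductive has_color :: "(row \<times> nat) set \<Rightarrow> nat \<Rightarrow> nat \<Rightarrow> bool" for S where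
  appended: "(Appended k, i) \<in> S \<Longrightarrow> has_color S i k"
| original: "(Original j, i) \<in> S \<Longrightarrow> has_color S j c \<Longrightarrow> has_color S i c"

definition color :: "(row \<times> nat) set \<Rightarrow> nat \<Rightarrow> nat" where
  "color S i = (THE c. has_color S i c)"

lemma placement_rook:
  assumes "E \<subseteq> {1..d} \<times> {1..d}" "S \<in> placements d E" "i \<in> {1..d}"
  shows "\<exists>!r. (r, i) \<in> S"
proof -
  have "snd ` S \<subseteq> {1..d}"
    using assms(1,2) by (fastforce simp: placements_def extended_board_def)
  moreover have "card (snd ` S) = d"
    using assms(2) by (simp add: placements_def card_image)
  ultimately have "snd ` S = {1..d}"
    by (simp add: card_subset_eq)
  with assms(3) have "i \<in> snd ` S" by simp
  then obtain r where r: "(r, i) \<in> S" by auto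
  moreover have "r' = r" if "(r', i) \<in> S" for r'
    using inj_onD [of snd S "(r', i)" "(r, i)"] assms(2) that r by (simp add: placements_def)
  ultimately show ?thesis by blast
qed

text \<open>The coloring is well defined because the digraph is acyclic.\<close>

lemma has_color_ex1:
  assumes E: "E \<subseteq> {1..d} \<times> {1..d}" "acyclic E" and S: "S \<in> placements d E"
    and i: "i \<in> {1..d}"
  shows "\<exists>!c. has_color S i c"
proof -
  have "finite E" using E(1) by (rule finite_subset) simp
  then have "wf E" using E(2) by (rule finite_acyclic_wf)
  then show ?thesis using i
  proof (induction i rule: wf_induct_rule)
    case (less i)
    obtain r where r: "(r, i) \<in> S" "\<And>r'. (r', i) \<in> S \<Longrightarrow> r' = r"
      using placement_rook [OF E(1) S less.prems] by blast
    show ?case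
    proof (cases r)
      case (Appended k)
      show ?thesis
      proof (rule ex1I)
        show "has_color S i k" using r(1) Appended by (auto intro: has_color.intros)
        show "c = k" if "has_color S i c" for c
          using that r(2) Appended by cases auto
      qed
    next
      case (Original j)
      then have "(j, i) \<in> E"
        using S r(1) by (auto simp: placements_def extended_board_def)
      moreover from this have "j \<in> {1..d}" using E(1) by auto
      ultimately obtain c where c: "has_color S j c" "\<And>c'. has_color S j c' \<Longrightarrow> c' = c"
        using less.IH by blast
      show ?thesis
      proof (rule ex1I)
        show "has_color S i c" using r(1) Original c(1) by (auto intro: has_color.intros)
        show "c' = c" if "has_color S i c'" for c'
          using that r(2) Original c(2) by cases auto
      qed
    qed
  qed
qed

definition placement_monomial :: "nat \<Rightarrow> (row \<times> nat) set \<Rightarrow> var series" where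
  "placement_monomial d S = (\<Prod>i\<in>{1..d}. indet (X (color S i)))"

definition T_eq :: "nat \<Rightarrow> (nat \<times> nat) set \<Rightarrow> nat set set \<Rightarrow> var series" where
  "T_eq d E P = formal_sum (placement_monomial d) {S \<in> placements d E. row_partition d S = P}"

definition T_ge :: "nat \<Rightarrow> (nat \<times> nat) set \<Rightarrow> nat set set \<Rightarrow> var series" where
  "T_ge d E P = (\<Sum>Q | refines {1..d} P Q. T_eq d E Q)"

end

theory Submission
  imports Defs "HOL-Library.FuncSet"
begin

text \<open>
  Expanding the upper sums \<open>T\<^sub>\<ge>\<^sub>\<pi>\<close> and exchanging the two summations gives every \<open>T\<^sub>\<sigma>\<close> the
  coefficient \<open>\<Sum>\<^sub>\<pi>\<^sub>\<le>\<^sub>\<sigma> \<mu>(0, \<pi>)\<close>, which by the very definition of \<open>\<mu>\<close> is \<open>1\<close> if \<open>\<sigma>\<close> is the minimum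
  and \<open>0\<close> otherwise (\<open>sum_partition_moebius_below\<close>). So the right-hand side is just \<open>T\<close> at the
  partition into singletons, that is, the sum of \<open>x\<^sup>R\<close> over the placements \<open>R\<close> that have no two rooks
  in the same row (\<open>row_partition_eq_singletons_iff\<close>).

  The rooks of such an \<open>R\<close> that lie on the board form a path-cycle cover \<open>S\<close>, which has no cycles
  because the digraph is acyclic. The columns whose rook lies in an appended row are those without
  a rook on the board: they are the vertices that no edge of \<open>S\<close> enters, hence the first vertices
  of the paths of \<open>S\<close>. The appended rows of their rooks are distinct, and every other vertex inherits
  the color of the first vertex of its path. Hence the placements \<open>R\<close> that belong to a given \<open>S\<close>
  correspond to the injective colorings of the paths of \<open>S\<close> (\<open>bij_betw_placement_of_cover\<close>), and
  \<open>x\<^sup>R\<close> contains the color of each path once for each of its vertices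
  (\<open>color_content_placement_of_cover\<close>).

  Summing over all injective colorings of parts of given sizes produces the augmented monomial
  symmetric function: a monomial with the right exponents arises once for each way to match parts
  with variables of equal exponent, and there are \<open>r\<^sub>1! r\<^sub>2! \<dots>\<close> such matchings
  (\<open>aug_monomial_sym_eq_sum_over_injections\<close>).

  Since infinite sums of series are taken coefficientwise, the two sides are compared as numbers
  of placements with a given monomial; these numbers are finite, as the monomial bounds the colors.
\<close>

section \<open>Coefficients of series\<close>

lemma coeff_monom: "coeff (monom M) N = (if N = M then 1 else 0)"
  by (simp add: monom_def)

lemma monom_add: "monom (A + B) = monom A * monom B"
proof (rule series_eqI)
  fix M
  have "coeff (monom A * monom B) M = (\<Sum>p\<in>splits M. if p = (A, B) then 1 else 0)"
    unfolding times_series_def coeff_Series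
    by (rule sum.cong) (auto simp: coeff_monom split: if_splits)
  also have "\<dots> = (if (A, B) \<in> splits M then 1 else 0)"
    by simp
  also have "\<dots> = coeff (monom (A + B)) M"
    by (auto simp: coeff_monom splits_def)
  finally show "coeff (monom (A + B)) M = coeff (monom A * monom B) M" ..
qed

lemma prod_monom: "(\<Prod>i\<in>I. monom (m i)) = monom (\<Sum>i\<in>I. m i)"
  by (induction I rule: infinite_finite_induct)
     (simp_all add: monom_add, simp_all add: monom_def one_series_def)

lemma coeff_zero: "coeff 0 M = 0"
  by (simp add: zero_series_def)

lemma coeff_add: "coeff (f + g) M = coeff f M + coeff g M"
  by (simp add: plus_series_def)

lemma coeff_sum: "coeff (\<Sum>i\<in>I. f i) M = (\<Sum>i\<in>I. coeff (f i) M)"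
  by (induction I rule: infinite_finite_induct) (simp_all add: coeff_zero coeff_add)

lemma coeff_of_nat_mult: "coeff (of_nat n * f) M = of_nat n * coeff f M"
  by (induction n) (simp_all add: coeff_zero coeff_add distrib_right)

lemma coeff_formal_sum_monom:
  "coeff (formal_sum (\<lambda>i. monom (m i)) I) M = int (card {i \<in> I. m i = M})"
proof -
  have "{i \<in> I. coeff (monom (m i)) M \<noteq> 0} = {i \<in> I. m i = M}"
    by (auto simp: coeff_monom)
  then show ?thesis
    by (simp add: formal_sum_def) (simp add: coeff_monom)
qed

section \<open>Augmented monomial symmetric functions as sums over injections\<close>

text \<open>
  The product \<open>r\<^sub>1! r\<^sub>2! \<dots>\<close> of an integer partition when a part is added to it: the recursion that
  the count of matchings below follows.
\<close>

lemma prod_fact_count_add_mset: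
  "(\<Prod>i\<in>set_mset (add_mset k l). fact (count (add_mset k l) i)) =
    (Suc (count l k) * (\<Prod>i\<in>set_mset l. fact (count l i)) :: nat)"
proof -
  have "(\<Prod>i\<in>set_mset (add_mset k l). fact (count (add_mset k l) i) :: nat) =
      fact (Suc (count l k)) * (\<Prod>i\<in>set_mset l - {k}. fact (count (add_mset k l) i))"
    by (simp add: prod.insert_remove)
  also have "(\<Prod>i\<in>set_mset l - {k}. fact (count (add_mset k l) i) :: nat) =
      (\<Prod>i\<in>set_mset l - {k}. fact (count l i))"
    by (rule prod.cong) auto
  also have "fact (Suc (count l k)) * (\<Prod>i\<in>set_mset l - {k}. fact (count l i)) =
      Suc (count l k) * (fact (count l k) * (\<Prod>i\<in>set_mset l - {k}. fact (count l i)) :: nat)"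
    by (simp add: algebra_simps)
  also have "fact (count l k) * (\<Prod>i\<in>set_mset l - {k}. fact (count l i)) =
      (\<Prod>i\<in>set_mset l. fact (count l i) :: nat)"
  proof (cases "k \<in># l")
    case True
    then show ?thesis by (simp add: prod.remove)
  next
    case False
    then show ?thesis by (simp add: not_in_iff)
  qed
  finally show ?thesis .
qed

text \<open>
  Equal weight multisets make the injections bijections that permute freely within each weight
  class, whence the product of factorials. In the induction the image of a new point \<open>b\<close> can be
  any \<open>c\<close> of the same weight, and the remaining points are matched with \<open>C - {c}\<close>; the weight
  multisets then still agree.
\<close>

lemma card_weight_preserving_injections:
  assumes "finite B" "finite C"
    and "image_mset w (mset_set B) = image_mset u (mset_set C)"
  shows "card {g \<in> B \<rightarrow>\<^sub>E C. inj_on g B \<and> (\<forall>b\<in>B. u (g b) = w b)} =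
    (\<Prod>k\<in>set_mset (image_mset w (mset_set B)). fact (count (image_mset w (mset_set B)) k))"
  using assms
proof (induction B arbitrary: C rule: finite_induct)
  case empty
  then show ?case by simp
next
  case (insert b B)
  define G where "G = (\<lambda>B C. {g \<in> B \<rightarrow>\<^sub>E C. inj_on g B \<and> (\<forall>b\<in>B. u (g b) = w b)})"
  define D where "D = {c \<in> C. u c = w b}"
  define l where "l = image_mset w (mset_set B)"
  have l: "add_mset (w b) l = image_mset u (mset_set C)"
    using insert.prems(2) insert.hyps by (simp add: l_def)
  have "Suc (count l (w b)) = count (image_mset u (mset_set C)) (w b)"
    by (simp flip: l)
  also have "\<dots> = (\<Sum>x | x \<in> C \<and> w b = u x. 1)"
    using insert.prems(1) by (simp add: count_image_mset')
  also have "\<dots> = card D"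
    by (simp add: D_def eq_commute)
  finally have card_D: "card D = Suc (count l (w b))" ..
  have bij: "bij_betw (\<lambda>(c, g). g(b := c)) (SIGMA c:D. G B (C - {c})) (G (insert b B) C)"
  proof (rule bij_betw_byWitness [where f' = "\<lambda>g. (g b, g(b := undefined))"])
    show "\<forall>p\<in>SIGMA c:D. G B (C - {c}). (\<lambda>g. (g b, g(b := undefined))) ((\<lambda>(c, g). g(b := c)) p) = p"
      using insert.hyps(2) by (auto simp: G_def PiE_def extensional_def fun_eq_iff)
    show "\<forall>g\<in>G (insert b B) C. (\<lambda>(c, g). g(b := c)) (g b, g(b := undefined)) = g"
      by auto
    show "(\<lambda>(c, g). g(b := c)) ` (SIGMA c:D. G B (C - {c})) \<subseteq> G (insert b B) C"
    proof clarify
      fix c g assume "c \<in> D" "g \<in> G B (C - {c})"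
      then show "g(b := c) \<in> G (insert b B) C"
        using insert.hyps(2) by (fastforce simp: G_def D_def PiE_def Pi_def extensional_def inj_on_def)
    qed
    show "(\<lambda>g. (g b, g(b := undefined))) ` G (insert b B) C \<subseteq> (SIGMA c:D. G B (C - {c}))"
    proof clarify
      fix g assume "g \<in> G (insert b B) C"
      then show "g b \<in> D \<and> g(b := undefined) \<in> G B (C - {g b})"
        using insert.hyps(2) by (fastforce simp: G_def D_def PiE_def Pi_def extensional_def inj_on_def)
    qed
  qed
  have card_G: "card (G B (C - {c})) = (\<Prod>k\<in>set_mset l. fact (count l k))" if "c \<in> D" for c
  proof -
    have "mset_set C = add_mset c (mset_set (C - {c}))"
      using that insert.prems(1) by (simp add: D_def mset_set.remove)
    then have "l = image_mset u (mset_set (C - {c}))"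
      using l that by (simp add: D_def)
    then show ?thesis
      using insert.IH [of "C - {c}"] insert.prems(1) by (simp add: G_def l_def)
  qed
  have "card (G (insert b B) C) = card (SIGMA c:D. G B (C - {c}))"
    using bij_betw_same_card [OF bij] ..
  also have "\<dots> = (\<Sum>c\<in>D. card (G B (C - {c})))"
    using insert.prems(1) insert.hyps(1) by (intro card_SigmaI) (auto simp: D_def G_def finite_PiE)
  also have "\<dots> = card D * (\<Prod>k\<in>set_mset l. fact (count l k))"
    by (simp add: card_G)
  also have "\<dots> = (\<Prod>k\<in>set_mset (add_mset (w b) l). fact (count (add_mset (w b) l) k))"
    by (simp only: prod_fact_count_add_mset card_D)
  also have "add_mset (w b) l = image_mset w (mset_set (insert b B))"
    using insert.hyps by (simp add: l_def)
  finally show ?case by (simp add: G_def)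
qed

text \<open>
  Positive weights ensure that every point contributes to the support of the monomial; by
  injectivity the exponents can be read off one point at a time.
\<close>

lemma sum_replicate_mset_eq_iff:
  assumes "finite B" "inj_on g B" "\<And>b. b \<in> B \<Longrightarrow> w b > 0"
  shows "(\<Sum>b\<in>B. replicate_mset (w b) (g b)) = M \<longleftrightarrow>
    g ` B = set_mset M \<and> (\<forall>b\<in>B. count M (g b) = w b)"
proof -
  define N where "N = (\<Sum>b\<in>B. replicate_mset (w b) (g b))"
  have count_N: "count N (g b) = w b" if "b \<in> B" for b
  proof -
    have "count N (g b) = (\<Sum>x\<in>B. if x = b then w b else 0)"
      unfolding N_def count_sum using that assms(2) by (intro sum.cong) (auto dest: inj_onD)
    then show ?thesis using that assms(1) by simp
  qed
  have "set_mset N = g ` B"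
    using assms(1,3) by (fastforce simp: N_def set_mset_sum)
  moreover have "N = M" if "g ` B = set_mset M" "\<forall>b\<in>B. count M (g b) = w b" "set_mset N = g ` B"
  proof (rule multiset_eqI)
    fix x
    show "count N x = count M x"
    proof (cases "x \<in> g ` B")
      case True
      then obtain b where "b \<in> B" "x = g b" by blast
      then show ?thesis using that(2) count_N by simp
    next
      case False
      then have "x \<notin># N" "x \<notin># M" using that by simp_all
      then show ?thesis by (simp add: not_in_iff)
    qed
  qed
  ultimately show ?thesis
    using count_N by (auto simp flip: N_def)
qed

text \<open>
  On the right the coefficient of a monomial \<open>M\<close> counts the injections \<open>f\<close> that send each \<open>b\<close> to a
  variable of exponent \<open>w b\<close> and exhaust the variables of \<open>M\<close>. There are none unless the exponents of
  \<open>M\<close> are the weights, and then these \<open>f\<close> are the weight-preserving injections from \<open>B\<close> into the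
  support of \<open>M\<close>, whose number is the factor that augments the monomial symmetric function.
\<close>

lemma aug_monomial_sym_eq_sum_over_injections:
  assumes v: "inj v" and B: "finite B" and w: "\<And>b. b \<in> B \<Longrightarrow> w b > 0"
  shows "aug_monomial_sym v (image_mset w (mset_set B)) =
    formal_sum (\<lambda>f. monom (\<Sum>b\<in>B. replicate_mset (w b) (v (f b))))
      {f \<in> B \<rightarrow>\<^sub>E UNIV. inj_on f B}"
proof (rule series_eqI)
  fix M
  define l where "l = image_mset w (mset_set B)"
  define F where "F = {f \<in> B \<rightarrow>\<^sub>E UNIV. inj_on f B \<and>
    v ` f ` B = set_mset M \<and> (\<forall>b\<in>B. count M (v (f b)) = w b)}"
  have "{f \<in> {f \<in> B \<rightarrow>\<^sub>E UNIV. inj_on f B}. (\<Sum>b\<in>B. replicate_mset (w b) (v (f b))) = M} = F"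
  proof -
    have "(\<Sum>b\<in>B. replicate_mset (w b) (v (f b))) = M \<longleftrightarrow>
      v ` f ` B = set_mset M \<and> (\<forall>b\<in>B. count M (v (f b)) = w b)" if "inj_on f B" for f
      using sum_replicate_mset_eq_iff [of B "v \<circ> f" w M] that v B w
      by (simp add: comp_inj_on inj_on_subset image_comp)
    then show ?thesis by (auto simp: F_def)
  qed
  then have rhs: "coeff (formal_sum (\<lambda>f. monom (\<Sum>b\<in>B. replicate_mset (w b) (v (f b))))
      {f \<in> B \<rightarrow>\<^sub>E UNIV. inj_on f B}) M = int (card F)"
    by (simp only: coeff_formal_sum_monom)
  have "{N. (set_mset N \<subseteq> range v \<and> exponents N = l) \<and> N = M} =
      (if set_mset M \<subseteq> range v \<and> exponents M = l then {M} else {})"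
    by auto
  then have lhs: "coeff (aug_monomial_sym v l) M =
      (if set_mset M \<subseteq> range v \<and> exponents M = l
       then int (\<Prod>i\<in>set_mset l. fact (count l i)) else 0)"
    unfolding aug_monomial_sym_def monomial_sym_def coeff_of_nat_mult
      coeff_formal_sum_monom [where m = "\<lambda>N. N"] by simp
  have "card F = (if set_mset M \<subseteq> range v \<and> exponents M = l
       then \<Prod>i\<in>set_mset l. fact (count l i) else 0)"
  proof (cases "set_mset M \<subseteq> range v \<and> exponents M = l")
    case True
    define G where "G = {g \<in> B \<rightarrow>\<^sub>E set_mset M. inj_on g B \<and> (\<forall>b\<in>B. count M (g b) = w b)}"
    (* B and the support of M have equal size, since both weight multisets equal l. *)
    have onto: "g ` B = set_mset M" if "g \<in> G" for g
    proof (rule card_subset_eq)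
      have "size (exponents M) = size l" using True by simp
      then show "card (g ` B) = card (set_mset M)"
        using that by (simp add: exponents_def l_def G_def card_image)
    qed (use that in \<open>auto simp: G_def\<close>)
    have "bij_betw (\<lambda>f. restrict (v \<circ> f) B) F G"
    proof (rule bij_betw_byWitness [where f' = "\<lambda>g. restrict (inv v \<circ> g) B"])
      show "\<forall>f\<in>F. restrict (inv v \<circ> restrict (v \<circ> f) B) B = f"
        using v by (auto simp: F_def fun_eq_iff restrict_def PiE_def extensional_def)
      show "\<forall>g\<in>G. restrict (v \<circ> restrict (inv v \<circ> g) B) B = g"
      proof
        fix g assume "g \<in> G"
        moreover then have "v (inv v (g b)) = g b" if "b \<in> B" for b
          using True that by (intro f_inv_into_f) (auto simp: G_def)
        ultimately show "restrict (v \<circ> restrict (inv v \<circ> g) B) B = g"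
          by (auto simp: G_def fun_eq_iff restrict_def PiE_def extensional_def)
      qed
      show "(\<lambda>f. restrict (v \<circ> f) B) ` F \<subseteq> G"
        using v by (auto simp: F_def G_def inj_on_def)
      show "(\<lambda>g. restrict (inv v \<circ> g) B) ` G \<subseteq> F"
      proof clarify
        fix g assume g: "g \<in> G"
        then have v_inv: "v (inv v (g b)) = g b" if "b \<in> B" for b
          using True that by (intro f_inv_into_f) (auto simp: G_def)
        have "inj_on (restrict (inv v \<circ> g) B) B"
          using g v_inv by (auto simp: G_def inj_on_def) metis
        moreover have "v ` restrict (inv v \<circ> g) B ` B = g ` B"
          using v_inv by (force simp: image_comp)
        ultimately show "restrict (inv v \<circ> g) B \<in> F"
          using g onto [OF g] v_inv by (simp add: F_def G_def)
      qed
    qed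
    then have "card F = card G" by (rule bij_betw_same_card)
    also have "\<dots> = (\<Prod>i\<in>set_mset l. fact (count l i))"
    proof -
      have "image_mset w (mset_set B) = image_mset (count M) (mset_set (set_mset M))"
        using True by (simp add: exponents_def l_def)
      from card_weight_preserving_injections [OF B finite_set_mset this]
      show ?thesis by (simp only: G_def l_def)
    qed
    finally show ?thesis using True by simp
  next
    case False
    have "f \<notin> F" for f
    proof
      assume f: "f \<in> F"
      then have "inj_on (v \<circ> f) B" and img: "(v \<circ> f) ` B = set_mset M"
        using v by (auto simp: F_def comp_inj_on inj_on_subset)
      then have "mset_set (set_mset M) = image_mset (v \<circ> f) (mset_set B)"
        by (simp add: image_mset_mset_set)
      moreover have "image_mset (count M \<circ> (v \<circ> f)) (mset_set B) = l"
        unfolding l_def using f B by (intro image_mset_cong) (simp add: F_def)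
      ultimately have "exponents M = l"
        by (simp add: exponents_def multiset.map_comp)
      moreover have "set_mset M \<subseteq> range v" using img by auto
      ultimately show False using False by simp
    qed
    then have "F = {}" by blast
    then show ?thesis using False by auto
  qed
  then show "coeff (aug_monomial_sym v (image_mset w (mset_set B))) M =
      coeff (formal_sum (\<lambda>f. monom (\<Sum>b\<in>B. replicate_mset (w b) (v (f b))))
        {f \<in> B \<rightarrow>\<^sub>E UNIV. inj_on f B}) M"
    unfolding rhs lhs [unfolded l_def] by (simp add: l_def)
qed

text \<open>
  All values of such an \<open>f\<close> are indices of variables that occur in \<open>M\<close>. Without this finiteness
  the cardinalities of infinite sets, which are \<open>0\<close> by convention, could not be added up.
\<close>

lemma finite_injections_with_content:
  assumes v: "inj v" and B: "finite B" and w: "\<And>b. b \<in> B \<Longrightarrow> w b > 0"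
  shows "finite {f \<in> B \<rightarrow>\<^sub>E UNIV. (\<Sum>b\<in>B. replicate_mset (w b) (v (f b))) = M}"
proof (rule finite_subset)
  show "{f \<in> B \<rightarrow>\<^sub>E UNIV. (\<Sum>b\<in>B. replicate_mset (w b) (v (f b))) = M} \<subseteq>
      B \<rightarrow>\<^sub>E v -` set_mset M"
    using B w by (fastforce simp: PiE_iff set_mset_sum)
  show "finite (B \<rightarrow>\<^sub>E v -` set_mset M)"
    using B v by (intro finite_PiE finite_vimageI) auto
qed

section \<open>The paths of a cover\<close>

lemma path_edges_Cons: "vs \<noteq> [] \<Longrightarrow> path_edges (v # vs) = insert (v, hd vs) (path_edges vs)"
  by (cases vs) (auto simp: path_edges_def)

lemma path_edges_into_tl: "(i, j) \<in> path_edges vs \<Longrightarrow> j \<in> set (tl vs)"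
  by (auto simp: path_edges_def dest: set_zip_rightD)

lemma path_edges_reachable:
  "path_edges vs \<subseteq> S \<Longrightarrow> v \<in> set vs \<Longrightarrow> (hd vs, v) \<in> S\<^sup>*"
proof (induction vs)
  case (Cons a vs)
  show ?case
  proof (cases "v = a")
    case False
    then have "vs \<noteq> []" "v \<in> set vs" using Cons.prems(2) by auto
    then show ?thesis
      using Cons.IH Cons.prems(1) by (auto simp: path_edges_Cons intro: converse_rtrancl_into_rtrancl)
  qed simp
qed simp

lemma cycle_edges_eq: "vs \<noteq> [] \<Longrightarrow> cycle_edges vs = insert (last vs, hd vs) (path_edges vs)"
proof -
  have "set (zip (a # ws) (ws @ [b])) = insert (last (a # ws), b) (set (zip (a # ws) ws))"
    for a b :: 'a and ws
    by (induction ws arbitrary: a) auto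
  then show "vs \<noteq> [] \<Longrightarrow> ?thesis"
    by (cases vs) (simp_all add: cycle_edges_def path_edges_def)
qed

text \<open>
  The edges of a cycle lead from its first vertex to its last and back, so its first vertex would
  reach itself.
\<close>

lemma cover_cycles_acyclic:
  assumes "acyclic S"
  shows "cover_cycles d S = {}"
proof -
  have False if "vs \<noteq> []" "incident_edges S (set vs) = cycle_edges vs" for vs
  proof -
    have "incident_edges S (set vs) \<subseteq> S" by (auto simp: incident_edges_def)
    then have sub: "insert (last vs, hd vs) (path_edges vs) \<subseteq> S"
      using that by (simp add: cycle_edges_eq)
    then have "(hd vs, last vs) \<in> S\<^sup>*"
      using that(1) by (intro path_edges_reachable) auto
    then have "(hd vs, hd vs) \<in> S\<^sup>+"
      using sub by (auto intro: rtrancl_into_trancl1)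
    then show False using assms by (simp add: acyclic_def)
  qed
  then show ?thesis by (auto simp: cover_cycles_def)
qed

text \<open>
  If every vertex has at most one outgoing edge, then the vertices reachable from \<open>v\<close> are found by
  following these edges; acyclicity guarantees that this walk stops and repeats no vertex.
\<close>

lemma reachable_set_is_path:
  assumes "finite S" "acyclic S" "inj_on fst S"
  shows "\<exists>vs. vs \<noteq> [] \<and> hd vs = v \<and> distinct vs \<and> set vs = S\<^sup>* `` {v} \<and>
    path_edges vs = {e \<in> S. fst e \<in> S\<^sup>* `` {v}}"
  using finite_acyclic_wf_converse [OF assms(1,2)]
proof (induction v rule: wf_induct_rule)
  case (less v)
  show ?case
  proof (cases "v \<in> Domain S")
    case False
    then have "S\<^sup>* `` {v} = {v}" by (auto elim: converse_rtranclE)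
    then show ?thesis
      using False by (intro exI [of _ "[v]"]) (auto simp: path_edges_def)
  next
    case True
    then obtain w where w: "(v, w) \<in> S" by blast
    have w_unique: "w' = w" if "(v, w') \<in> S" for w'
      using inj_onD [OF assms(3), of "(v, w')" "(v, w)"] that w by simp
    obtain vs where vs: "vs \<noteq> []" "hd vs = w" "distinct vs" "set vs = S\<^sup>* `` {w}"
        "path_edges vs = {e \<in> S. fst e \<in> S\<^sup>* `` {w}}"
      using less.IH [of w] w by auto
    have reach: "S\<^sup>* `` {v} = insert v (S\<^sup>* `` {w})"
    proof (intro equalityI subsetI)
      fix u assume "u \<in> S\<^sup>* `` {v}"
      then have "(v, u) \<in> S\<^sup>*" by simp
      then show "u \<in> insert v (S\<^sup>* `` {w})"
        by (cases rule: converse_rtranclE) (use w_unique in auto)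
    next
      fix u assume "u \<in> insert v (S\<^sup>* `` {w})"
      then show "u \<in> S\<^sup>* `` {v}"
        using w by (auto intro: converse_rtrancl_into_rtrancl)
    qed
    have "(w, v) \<notin> S\<^sup>*"
      using assms(2) w rtrancl_into_trancl2 [of v w S v] by (auto simp: acyclic_def)
    then have "distinct (v # vs)" unfolding distinct.simps vs(4) using vs(3) by blast
    moreover have "path_edges (v # vs) = {e \<in> S. fst e \<in> S\<^sup>* `` {v}}"
    proof -
      have "{e \<in> S. fst e = v} = {(v, w)}" using w by (auto dest: w_unique)
      then have "{e \<in> S. fst e \<in> S\<^sup>* `` {v}} = insert (v, w) {e \<in> S. fst e \<in> S\<^sup>* `` {w}}"
        unfolding reach by blast
      then show ?thesis using vs by (simp add: path_edges_Cons)
    qed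
    moreover have "set (v # vs) = S\<^sup>* `` {v}" unfolding reach by (simp add: vs(4))
    ultimately show ?thesis
      by (intro exI [of _ "v # vs"]) (simp del: Image_singleton_iff)
  qed
qed

text \<open>
  For a cover these are the first vertices of the paths; on the board they are the columns that
  contain no rook.
\<close>

definition sources :: "nat \<Rightarrow> (nat \<times> nat) set \<Rightarrow> nat set" where
  "sources d S = {1..d} - snd ` S"

lemma source_no_edge: "h \<in> sources d S \<Longrightarrow> (i, h) \<notin> S"
  by (force simp: sources_def)

lemma reachable_in_range:
  assumes "S \<subseteq> {1..d} \<times> {1..d}" "v \<in> {1..d}"
  shows "S\<^sup>* `` {v} \<subseteq> {1..d}"
proof clarify
  fix w assume "(v, w) \<in> S\<^sup>*"
  then show "w \<in> {1..d}" using assms by induction auto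
qed

text \<open>
  A path component starts at a source and is closed under outgoing edges. Conversely the walk
  from a source is a full component: an edge that enters it anywhere after the source must be the
  edge of the walk itself, because edges with equal endpoint coincide.
\<close>

lemma cover_paths_eq:
  assumes S: "S \<subseteq> {1..d} \<times> {1..d}" "acyclic S" "inj_on fst S" "inj_on snd S"
  shows "cover_paths d S = (\<lambda>h. S\<^sup>* `` {h}) ` sources d S"
proof (intro equalityI subsetI)
  fix V assume "V \<in> cover_paths d S"
  then obtain vs where vs: "V = set vs" "vs \<noteq> []" "distinct vs" "set vs \<subseteq> {1..d}"
      "incident_edges S (set vs) = path_edges vs"
    by (auto simp: cover_paths_def)
  have "(i, hd vs) \<notin> S" for i
  proof
    assume "(i, hd vs) \<in> S"
    then have "(i, hd vs) \<in> incident_edges S (set vs)"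
      using vs(2) by (simp add: incident_edges_def)
    then have "hd vs \<in> set (tl vs)" using vs(5) path_edges_into_tl by metis
    then show False using vs(2,3) by (cases vs) auto
  qed
  then have "hd vs \<in> sources d S"
    using hd_in_set [OF vs(2)] vs(4) by (force simp: sources_def)
  moreover have "set vs = S\<^sup>* `` {hd vs}"
  proof (intro equalityI subsetI)
    fix v assume "v \<in> set vs"
    moreover have "path_edges vs \<subseteq> S" using vs(5) by (auto simp: incident_edges_def)
    ultimately show "v \<in> S\<^sup>* `` {hd vs}" by (simp add: path_edges_reachable)
  next
    fix v assume "v \<in> S\<^sup>* `` {hd vs}"
    then have "(hd vs, v) \<in> S\<^sup>*" by simp
    then show "v \<in> set vs"
    proof induction
      case base
      show ?case using vs(2) by simp
    next
      case (step i j)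
      then have "(i, j) \<in> incident_edges S (set vs)" by (simp add: incident_edges_def)
      then have "j \<in> set (tl vs)" using vs(5) path_edges_into_tl by metis
      then show ?case using vs(2) by (simp add: list.set_sel(2))
    qed
  qed
  ultimately show "V \<in> (\<lambda>h. S\<^sup>* `` {h}) ` sources d S" using vs(1) by blast
next
  fix V assume "V \<in> (\<lambda>h. S\<^sup>* `` {h}) ` sources d S"
  then obtain h where h: "h \<in> sources d S" "V = S\<^sup>* `` {h}" by blast
  have "finite S" using S(1) by (rule finite_subset) simp
  then obtain vs where vs: "vs \<noteq> []" "hd vs = h" "distinct vs" "set vs = V"
      "path_edges vs = {e \<in> S. fst e \<in> V}"
    using reachable_set_is_path [OF _ S(2,3)] h(2) by blast
  have "i \<in> V" if "(i, j) \<in> S" "j \<in> V" for i j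
  proof -
    have "(h, j) \<in> S\<^sup>*" "j \<noteq> h" using that h source_no_edge by auto
    then obtain i' where "(h, i') \<in> S\<^sup>*" "(i', j) \<in> S" by (blast elim: rtranclE)
    moreover from this have "i' = i"
      using inj_onD [OF S(4), of "(i', j)" "(i, j)"] that by simp
    ultimately show "i \<in> V" using h(2) by simp
  qed
  then have "incident_edges S V = path_edges vs"
    by (auto simp: incident_edges_def vs(5))
  moreover have "V \<subseteq> {1..d}"
    using h reachable_in_range [OF S(1), of h] by (simp add: sources_def)
  ultimately show "V \<in> cover_paths d S"
    using vs by (auto simp: cover_paths_def)
qed

text \<open>
  Going backwards along the edges is deterministic when each vertex has at most one incoming edge,
  so two sources that reach the same vertex coincide.
\<close>

lemma source_unique:
  assumes "inj_on snd S" "h \<in> sources d S" "h' \<in> sources d S"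
    and "(h, v) \<in> S\<^sup>*" "(h', v) \<in> S\<^sup>*"
  shows "h = h'"
  using assms(4,5)
proof (induction rule: rtrancl_induct)
  case base
  then show ?case using source_no_edge [OF assms(2)] by (cases rule: rtranclE) auto
next
  case (step i j)
  from step.prems show ?case
  proof (cases rule: rtranclE)
    case base
    then show ?thesis using step.hyps(2) source_no_edge [OF assms(3)] by auto
  next
    case (step i')
    then have "i' = i"
      using inj_onD [OF assms(1), of "(i', j)" "(i, j)"] \<open>(i, j) \<in> S\<close> by simp
    then show ?thesis using step(1) \<open>(h', i) \<in> S\<^sup>* \<Longrightarrow> h = h'\<close> by simp
  qed
qed

lemma source_exists:
  assumes "S \<subseteq> {1..d} \<times> {1..d}" "acyclic S" "v \<in> {1..d}"
  shows "\<exists>h\<in>sources d S. (h, v) \<in> S\<^sup>*"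
proof -
  have "finite S" using assms(1) by (rule finite_subset) simp
  then have "wf S" using assms(2) by (rule finite_acyclic_wf)
  then show ?thesis using assms(3)
  proof (induction v rule: wf_induct_rule)
    case (less v)
    show ?case
    proof (cases "v \<in> sources d S")
      case False
      then obtain u where u: "(u, v) \<in> S" using less.prems by (auto simp: sources_def)
      then obtain h where "h \<in> sources d S" "(h, u) \<in> S\<^sup>*"
        using less.IH [of u] assms(1) by blast
      then show ?thesis using u by (auto intro: rtrancl_into_rtrancl)
    qed auto
  qed
qed

lemma partition_type_cover_paths:
  assumes S: "S \<subseteq> {1..d} \<times> {1..d}" "acyclic S" "inj_on fst S" "inj_on snd S"
  shows "partition_type (cover_paths d S) =
    image_mset (\<lambda>h. card (S\<^sup>* `` {h})) (mset_set (sources d S))"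
proof -
  have "inj_on (\<lambda>h. S\<^sup>* `` {h}) (sources d S)"
  proof (rule inj_onI)
    fix h h' assume "h \<in> sources d S" "h' \<in> sources d S" "S\<^sup>* `` {h} = S\<^sup>* `` {h'}"
    then show "h = h'" using source_unique [OF S(4), of h d h' h'] by blast
  qed
  then show ?thesis
    unfolding partition_type_def cover_paths_eq [OF S]
    by (simp add: image_mset_mset_set [symmetric] multiset.map_comp comp_def)
qed

section \<open>Placements with all rooks in distinct rows\<close>

definition placement_of_cover :: "nat \<Rightarrow> (nat \<times> nat) set \<Rightarrow> (nat \<Rightarrow> nat) \<Rightarrow> (row \<times> nat) set" where
  "placement_of_cover d S f =
     {(Original i, j) | i j. (i, j) \<in> S} \<union> {(Appended (f h), h) | h. h \<in> sources d S}"

definition original_rooks :: "(row \<times> nat) set \<Rightarrow> (nat \<times> nat) set" where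
  "original_rooks R = {(i, j). (Original i, j) \<in> R}"

text \<open>
  This identifies the placements that survive the Moebius inversion: the nonattacking ones.
\<close>

lemma row_partition_eq_singletons_iff:
  assumes E: "E \<subseteq> {1..d} \<times> {1..d}" and R: "R \<in> placements d E"
  shows "row_partition d R = singletons {1..d} \<longleftrightarrow> inj_on fst R"
proof -
  define r where "r = {(i, j). i \<in> {1..d} \<and> j \<in> {1..d} \<and> (\<exists>\<rho>. (\<rho>, i) \<in> R \<and> (\<rho>, j) \<in> R)}"
  have col: "j \<in> {1..d}" if "(\<rho>, j) \<in> R" for \<rho> j
    using that E R by (fastforce simp: placements_def extended_board_def)
  have refl: "v \<in> r `` {v}" if v: "v \<in> {1..d}" for v
  proof -
    have "\<exists>\<rho>. (\<rho>, v) \<in> R" using placement_rook [OF E R v] by blast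
    then show ?thesis using v by (auto simp: r_def)
  qed
  have rp: "row_partition d R = {1..d} // r" by (simp only: row_partition_def r_def)
  have "row_partition d R = singletons {1..d} \<longleftrightarrow> (\<forall>v\<in>{1..d}. r `` {v} = {v})"
  proof
    assume eq: "row_partition d R = singletons {1..d}"
    show "\<forall>v\<in>{1..d}. r `` {v} = {v}"
    proof
      fix v assume v: "v \<in> {1..d}"
      then have "r `` {v} \<in> singletons {1..d}"
        using quotientI [of v "{1..d}" r] eq rp by simp
      then obtain a where "r `` {v} = {a}" by (auto simp: singletons_def)
      then show "r `` {v} = {v}" using refl [OF v] by (metis singletonD)
    qed
  next
    assume "\<forall>v\<in>{1..d}. r `` {v} = {v}"
    then show "row_partition d R = singletons {1..d}"
      unfolding rp quotient_def singletons_def by (simp del: Image_singleton_iff) blast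
  qed
  also have "\<dots> \<longleftrightarrow> inj_on fst R"
  proof
    assume *: "\<forall>v\<in>{1..d}. r `` {v} = {v}"
    show "inj_on fst R"
    proof (rule inj_onI)
      fix a b assume ab: "a \<in> R" "b \<in> R" "fst a = fst b"
      obtain \<rho> i j where eqs: "a = (\<rho>, i)" "b = (\<rho>, j)"
        using ab(3) by (metis prod.collapse)
      then have j: "j \<in> r `` {i}" and "i \<in> {1..d}"
        using ab col by (auto simp: r_def)
      then have "r `` {i} = {i}" using * by simp
      then have "j = i" using j by (simp only: singleton_iff)
      then show "a = b" using eqs by simp
    qed
  next
    assume inj: "inj_on fst R"
    have "i = j" if "(i, j) \<in> r" for i j
    proof -
      have "\<exists>\<rho>. (\<rho>, i) \<in> R \<and> (\<rho>, j) \<in> R" using that by (simp add: r_def)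
      then obtain \<rho> where "(\<rho>, i) \<in> R" "(\<rho>, j) \<in> R" by blast
      then show ?thesis using inj_onD [OF inj, of "(\<rho>, i)" "(\<rho>, j)"] by simp
    qed
    then show "\<forall>v\<in>{1..d}. r `` {v} = {v}" using refl by blast
  qed
  finally show ?thesis .
qed

lemma original_rooks_cover:
  assumes "R \<in> placements d E" "inj_on fst R"
  shows "original_rooks R \<in> path_cycle_covers E"
proof -
  have "inj_on snd R" using assms(1) by (simp add: placements_def)
  then have "inj_on snd (original_rooks R)" "inj_on fst (original_rooks R)"
    using assms(2) by (fastforce simp: original_rooks_def inj_on_def)+
  moreover have "original_rooks R \<subseteq> E"
    using assms(1) by (auto simp: original_rooks_def placements_def extended_board_def)
  ultimately show ?thesis by (simp add: path_cycle_covers_def)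
qed

lemma placement_of_cover_in_placements:
  assumes E: "E \<subseteq> {1..d} \<times> {1..d}" and S: "S \<in> path_cycle_covers E"
  shows "placement_of_cover d S f \<in> placements d E"
proof -
  let ?R = "placement_of_cover d S f"
  have S': "S \<subseteq> E" "inj_on snd S" using S by (auto simp: path_cycle_covers_def)
  have "finite S" using S'(1) E by (meson finite_SigmaI finite_atLeastAtMost finite_subset)
  moreover have R_eq:
    "?R = (\<lambda>(i, j). (Original i, j)) ` S \<union> (\<lambda>h. (Appended (f h), h)) ` sources d S"
    by (auto simp: placement_of_cover_def)
  ultimately have "finite ?R" by (simp add: sources_def)
  moreover have "?R \<subseteq> extended_board d E"
    using S'(1) by (auto simp: placement_of_cover_def extended_board_def sources_def)
  moreover have inj: "inj_on snd ?R"
    using S'(2) by (fastforce simp: placement_of_cover_def inj_on_def dest: source_no_edge)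
  moreover have "card ?R = d"
  proof -
    have "snd ` ?R = snd ` S \<union> sources d S"
      by (simp add: R_eq image_Un image_image case_prod_unfold)
    also have "\<dots> = {1..d}" using S'(1) E by (auto simp: sources_def)
    finally have "snd ` ?R = {1..d}" .
    then show ?thesis using card_image [OF inj] by simp
  qed
  ultimately show ?thesis by (simp add: placements_def)
qed

text \<open>
  Each column holds exactly one rook. For the columns that \<open>S\<close> does not use, that rook must lie in
  an appended row, whose choice is the only freedom left; two rooks share no row precisely when
  these rows are distinct.
\<close>

lemma bij_betw_placement_of_cover:
  assumes E: "E \<subseteq> {1..d} \<times> {1..d}" and S: "S \<in> path_cycle_covers E"
  shows "bij_betw (placement_of_cover d S)
    {f \<in> sources d S \<rightarrow>\<^sub>E (UNIV :: nat set). inj_on f (sources d S)}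
    {R \<in> placements d E. inj_on fst R \<and> original_rooks R = S}"
    (is "bij_betw _ ?F ?P")
proof -
  define g where "g R h = (THE k. (Appended k, h) \<in> R)" for R :: "(row \<times> nat) set" and h
  (* The rooks of R outside S are exactly those that g R describes. *)
  have rook: "(Appended k, h) \<in> R \<longleftrightarrow> h \<in> sources d S \<and> k = g R h"
    if R: "R \<in> ?P" for R k h
  proof -
    have pl: "R \<in> placements d E" and orig: "original_rooks R = S" using R by auto
    have "\<exists>!k. (Appended k, h) \<in> R" if h: "h \<in> sources d S"
    proof -
      have "(Original i, h) \<notin> R" for i
        using orig source_no_edge [OF h] by (auto simp: original_rooks_def)
      moreover have "\<exists>!\<rho>. (\<rho>, h) \<in> R"
        using placement_rook [OF E pl] h by (simp add: sources_def)
      ultimately show ?thesis by (metis row.exhaust row.inject(2))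
    qed
    moreover have "h \<in> sources d S" if k: "(Appended k, h) \<in> R"
    proof -
      have "h \<in> {1..d}" using k pl E by (auto simp: placements_def extended_board_def)
      moreover from this have "(Original i, h) \<notin> R" for i
        using placement_rook [OF E pl] k by blast
      ultimately show ?thesis using orig by (auto simp: sources_def original_rooks_def)
    qed
    ultimately show ?thesis
      unfolding g_def by (metis (mono_tags, lifting) the1_equality)
  qed
  show ?thesis
  proof (rule bij_betw_byWitness [where f' = "\<lambda>R. restrict (g R) (sources d S)"])
    show "\<forall>f\<in>?F. restrict (g (placement_of_cover d S f)) (sources d S) = f"
      by (auto simp: g_def placement_of_cover_def fun_eq_iff PiE_def extensional_def)
    show "placement_of_cover d S ` ?F \<subseteq> ?P"
    proof clarify
      fix f :: "nat \<Rightarrow> nat" assume f: "inj_on f (sources d S)"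
      have "inj_on fst S" using S by (simp add: path_cycle_covers_def)
      have "inj_on fst (placement_of_cover d S f)"
      proof (rule inj_onI)
        fix a b
        assume "a \<in> placement_of_cover d S f" "b \<in> placement_of_cover d S f" "fst a = fst b"
        then consider
            i j j' where "a = (Original i, j)" "b = (Original i, j')" "(i, j) \<in> S" "(i, j') \<in> S"
          | h h' where "a = (Appended (f h), h)" "b = (Appended (f h'), h')"
              "h \<in> sources d S" "h' \<in> sources d S" "f h = f h'"
          by (auto simp: placement_of_cover_def)
        then show "a = b"
        proof cases
          case 1
          then show ?thesis using inj_onD [OF \<open>inj_on fst S\<close>, of "(i, j)" "(i, j')"] by simp
        next
          case 2
          then show ?thesis using inj_onD [OF f, of h h'] by simp
        qed
      qed
      moreover have "original_rooks (placement_of_cover d S f) = S"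
        by (auto simp: original_rooks_def placement_of_cover_def)
      ultimately show "placement_of_cover d S f \<in> placements d E \<and>
          inj_on fst (placement_of_cover d S f) \<and> original_rooks (placement_of_cover d S f) = S"
        using placement_of_cover_in_placements [OF E S] by blast
    qed
    show "\<forall>R\<in>?P. placement_of_cover d S (restrict (g R) (sources d S)) = R"
    proof
      fix R assume R: "R \<in> ?P"
      then have orig: "(Original i, j) \<in> R \<longleftrightarrow> (i, j) \<in> S" for i j
        by (auto simp: original_rooks_def)
      have "(\<rho>, j) \<in> placement_of_cover d S (restrict (g R) (sources d S)) \<longleftrightarrow>
          (\<rho>, j) \<in> R" for \<rho> j
        by (cases \<rho>) (auto simp: placement_of_cover_def orig rook [OF R])
      then show "placement_of_cover d S (restrict (g R) (sources d S)) = R"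
        by auto
    qed
    show "(\<lambda>R. restrict (g R) (sources d S)) ` ?P \<subseteq> ?F"
    proof (intro subsetI, elim imageE)
      fix R f assume R: "R \<in> ?P" and f: "f = restrict (g R) (sources d S)"
      have "inj_on (g R) (sources d S)"
      proof (rule inj_onI)
        fix h h' assume *: "h \<in> sources d S" "h' \<in> sources d S" "g R h = g R h'"
        then have "(Appended (g R h), h) \<in> R" "(Appended (g R h), h') \<in> R"
          using rook [OF R] by simp_all
        moreover have "inj_on fst R" using R by simp
        ultimately show "h = h'" by (metis fst_conv inj_onD prod.inject)
      qed
      then show "f \<in> ?F" by (simp add: f inj_on_restrict_eq)
    qed
  qed
qed

definition color_content :: "nat \<Rightarrow> (row \<times> nat) set \<Rightarrow> var multiset" where
  "color_content d R = (\<Sum>i\<in>{1..d}. {#X (color R i)#})"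

text \<open>
  A color is passed on along each edge of \<open>S\<close>, so it is constant along a path.
\<close>

lemma color_placement_of_cover:
  assumes E: "E \<subseteq> {1..d} \<times> {1..d}" "acyclic E" and S: "S \<in> path_cycle_covers E"
    and h: "h \<in> sources d S" and v: "(h, v) \<in> S\<^sup>*"
  shows "color (placement_of_cover d S f) v = f h"
proof -
  let ?R = "placement_of_cover d S f"
  have "S \<subseteq> {1..d} \<times> {1..d}" using E(1) S by (auto simp: path_cycle_covers_def)
  then have "v \<in> {1..d}"
    using reachable_in_range [of S d h] h v by (auto simp: sources_def)
  then have "\<exists>!c. has_color ?R v c"
    using has_color_ex1 [OF E placement_of_cover_in_placements [OF E(1) S]] by blast
  moreover have "has_color ?R v (f h)"
    using v
  proof induction
    case base
    show ?case using h by (intro has_color.appended) (auto simp: placement_of_cover_def)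
  next
    case (step i j)
    then show ?case by (intro has_color.original [of i j]) (auto simp: placement_of_cover_def)
  qed
  ultimately show ?thesis by (simp add: color_def the1_equality)
qed

text \<open>
  Each vertex lies on the path of exactly one source, so the product over the vertices can be
  grouped by paths.
\<close>

lemma color_content_placement_of_cover:
  assumes E: "E \<subseteq> {1..d} \<times> {1..d}" "acyclic E" and S: "S \<in> path_cycle_covers E"
  shows "color_content d (placement_of_cover d S f) =
    (\<Sum>h\<in>sources d S. replicate_mset (card (S\<^sup>* `` {h})) (X (f h)))"
proof -
  let ?R = "placement_of_cover d S f"
  have S': "S \<subseteq> {1..d} \<times> {1..d}" "acyclic S" "inj_on snd S"
    using E S acyclic_subset [of E S] by (auto simp: path_cycle_covers_def)
  have fin: "finite (S\<^sup>* `` {h})" if "h \<in> sources d S" for h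
    using reachable_in_range [OF S'(1), of h] that finite_subset by (fastforce simp: sources_def)
  have "{1..d} = (\<Union>h\<in>sources d S. S\<^sup>* `` {h})"
  proof (intro equalityI subsetI)
    fix v assume "v \<in> {1..d}"
    then show "v \<in> (\<Union>h\<in>sources d S. S\<^sup>* `` {h})" using source_exists [OF S'(1,2)] by blast
  next
    fix v assume "v \<in> (\<Union>h\<in>sources d S. S\<^sup>* `` {h})"
    then obtain h where "h \<in> {1..d}" "v \<in> S\<^sup>* `` {h}" by (auto simp: sources_def)
    then show "v \<in> {1..d}" using reachable_in_range [OF S'(1)] by blast
  qed
  then have "color_content d ?R = (\<Sum>v\<in>(\<Union>h\<in>sources d S. S\<^sup>* `` {h}). {#X (color ?R v)#})"
    by (simp add: color_content_def)
  also have "\<dots> = (\<Sum>h\<in>sources d S. \<Sum>v\<in>S\<^sup>* `` {h}. {#X (color ?R v)#})"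
  proof (rule sum.UNION_disjoint)
    show "\<forall>h\<in>sources d S. \<forall>h'\<in>sources d S. h \<noteq> h' \<longrightarrow> S\<^sup>* `` {h} \<inter> S\<^sup>* `` {h'} = {}"
      using source_unique [OF S'(3)] by blast
  qed (use fin in \<open>auto simp: sources_def\<close>)
  also have "\<dots> = (\<Sum>h\<in>sources d S. replicate_mset (card (S\<^sup>* `` {h})) (X (f h)))"
  proof (rule sum.cong)
    fix h assume h: "h \<in> sources d S"
    have const: "(\<Sum>v\<in>A. {#x#}) = replicate_mset (card A) x" if "finite A" for A :: "nat set" and x :: var
      using that by induction simp_all
    have "(\<Sum>v\<in>S\<^sup>* `` {h}. {#X (color ?R v)#}) = (\<Sum>v\<in>S\<^sup>* `` {h}. {#X (f h)#})"
      by (rule sum.cong) (simp_all add: color_placement_of_cover [OF E S h])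
    then show "(\<Sum>v\<in>S\<^sup>* `` {h}. {#X (color ?R v)#}) =
        replicate_mset (card (S\<^sup>* `` {h})) (X (f h))"
      using const [OF fin [OF h]] by simp
  qed simp
  finally show ?thesis .
qed

section \<open>Moebius inversion\<close>

text \<open>
  The defining recursion of \<open>\<mu>\<close> says that the values on an interval from the minimum to some \<open>Q\<close>
  above it add up to zero.
\<close>

lemma sum_partition_moebius_below:
  assumes "finite A" "partition_on A Q"
  shows "(\<Sum>P | partition_on A P \<and> refines A P Q. partition_moebius A (singletons A) P) =
    (if Q = singletons A then 1 else 0)"
proof -
  have part: "partition_on A (singletons A)"
    by (rule partition_onI) (auto simp: singletons_def disjnt_def)
  have least: "refines A (singletons A) P" if "partition_on A P" for P
    using that part by (auto simp: refines_def singletons_def partition_on_def)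
  define L where "L = {P. partition_on A P \<and> refines A P Q}"
  have fin: "finite L"
    unfolding L_def using finitely_many_partition_on [OF assms(1)] by simp
  show ?thesis
  proof (cases "Q = singletons A")
    case True
    then have "L = {singletons A}"
      using least part by (auto simp: L_def refines_refl dest: refines_asym)
    moreover have "partition_moebius A (singletons A) (singletons A) = 1"
      using assms(1) least [OF part] by (subst partition_moebius.simps) simp
    ultimately show ?thesis unfolding L_def [symmetric] using True by simp
  next
    case False
    have "partition_moebius A (singletons A) Q =
        - (\<Sum>P | refines A (singletons A) P \<and> refines A P Q \<and> P \<noteq> Q.
             partition_moebius A (singletons A) P)"
      using assms least [OF assms(2)] False by (subst partition_moebius.simps) auto
    also have "{P. refines A (singletons A) P \<and> refines A P Q \<and> P \<noteq> Q} = L - {Q}"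
      using least by (auto simp: L_def refines_def)
    finally have "partition_moebius A (singletons A) Q =
        - (\<Sum>P\<in>L - {Q}. partition_moebius A (singletons A) P)" .
    moreover have "Q \<in> L" using assms(2) by (simp add: L_def refines_refl)
    ultimately show ?thesis
      unfolding L_def [symmetric] using False fin by (simp add: sum.remove [of L Q])
  qed
qed

lemma sum_partition_moebius_T_ge:
  "(\<Sum>P | partition_on {1..d} P.
      of_int (partition_moebius {1..d} (singletons {1..d}) P) * T_ge d E P) =
    T_eq d E (singletons {1..d})"
proof -
  let ?A = "{1..d}"
  let ?mu = "\<lambda>P. of_int (partition_moebius ?A (singletons ?A) P) :: var series"
  have fin: "finite {P. partition_on ?A P}" by (simp add: finitely_many_partition_on)
  have part: "partition_on ?A (singletons ?A)"
    by (rule partition_onI) (auto simp: singletons_def disjnt_def)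
  have "(\<Sum>P | partition_on ?A P. ?mu P * T_ge d E P) =
      (\<Sum>P | partition_on ?A P. \<Sum>Q | Q \<in> {Q. partition_on ?A Q} \<and> refines ?A P Q.
        ?mu P * T_eq d E Q)"
    unfolding T_ge_def sum_distrib_left
    by (intro sum.cong) (auto simp: refines_def)
  also have "\<dots> = (\<Sum>Q | partition_on ?A Q. \<Sum>P | P \<in> {P. partition_on ?A P} \<and> refines ?A P Q.
        ?mu P * T_eq d E Q)"
    by (rule sum.swap_restrict [OF fin fin])
  also have "\<dots> = (\<Sum>Q | partition_on ?A Q.
      of_int (\<Sum>P | partition_on ?A P \<and> refines ?A P Q. partition_moebius ?A (singletons ?A) P) *
        T_eq d E Q)"
    by (simp add: sum_distrib_right)
  also have "\<dots> = (\<Sum>Q | partition_on ?A Q. if Q = singletons ?A then T_eq d E Q else 0)"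
    by (rule sum.cong) (auto simp: sum_partition_moebius_below)
  also have "\<dots> = T_eq d E (singletons ?A)"
    using fin part by (simp add: sum.delta)
  finally show ?thesis .
qed

section \<open>Comparison of coefficients\<close>

lemma placement_monomial_eq: "placement_monomial d R = monom (color_content d R)"
  by (simp add: placement_monomial_def color_content_def indet_def prod_monom)

lemma coeff_T_eq_singletons:
  assumes E: "E \<subseteq> {1..d} \<times> {1..d}"
  shows "coeff (T_eq d E (singletons {1..d})) M =
    int (card {R \<in> placements d E. inj_on fst R \<and> color_content d R = M})"
proof -
  have "{R \<in> {R \<in> placements d E. row_partition d R = singletons {1..d}}. color_content d R = M} =
      {R \<in> placements d E. inj_on fst R \<and> color_content d R = M}"
    using row_partition_eq_singletons_iff [OF E] by blast
  then show ?thesis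
    unfolding T_eq_def placement_monomial_eq [abs_def] coeff_formal_sum_monom by simp
qed

text \<open>
  The contribution of one cover \<open>S\<close> to the path-cycle symmetric function is the sum over the
  placements whose rooks on the board are \<open>S\<close>: both equal the sum over injective colorings of the
  sources, each weighted by the number of vertices on its path.
\<close>

lemma coeff_cover_term:
  assumes E: "E \<subseteq> {1..d} \<times> {1..d}" "acyclic E" and S: "S \<in> path_cycle_covers E"
  defines "Rs \<equiv> \<lambda>M. {R \<in> placements d E. inj_on fst R \<and> original_rooks R = S \<and> color_content d R = M}"
  shows "finite (Rs M)"
    and "coeff (aug_monomial_sym X (partition_type (cover_paths d S))) M = int (card (Rs M))"
proof -
  let ?w = "\<lambda>h. card (S\<^sup>* `` {h})"
  define F where "F = {f \<in> sources d S \<rightarrow>\<^sub>E (UNIV :: nat set). inj_on f (sources d S)}"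
  define F' where "F' = {f \<in> F. (\<Sum>h\<in>sources d S. replicate_mset (?w h) (X (f h))) = M}"
  have "S \<subseteq> E" and S_inj: "inj_on fst S" "inj_on snd S"
    using S by (auto simp: path_cycle_covers_def)
  then have "S \<subseteq> {1..d} \<times> {1..d}" "acyclic S"
    using E acyclic_subset by blast+
  note S' = this S_inj
  have X: "inj X" by (simp add: inj_def)
  have fin: "finite (sources d S)" by (simp add: sources_def)
  have w: "?w h > 0" if "h \<in> sources d S" for h
  proof -
    have "S\<^sup>* `` {h} \<subseteq> {1..d}"
      using that reachable_in_range [OF S'(1), of h] by (simp add: sources_def)
    then have "finite (S\<^sup>* `` {h})" by (rule finite_subset) simp
    then show ?thesis by (auto simp: card_gt_0_iff)
  qed
  have bij: "bij_betw (placement_of_cover d S) F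
      {R \<in> placements d E. inj_on fst R \<and> original_rooks R = S}"
    unfolding F_def by (rule bij_betw_placement_of_cover [OF E(1) S])
  have "Rs M = {R \<in> placement_of_cover d S ` F. color_content d R = M}"
    using bij by (auto simp: Rs_def bij_betw_def)
  also have "\<dots> = placement_of_cover d S ` F'"
    by (auto simp: F'_def color_content_placement_of_cover [OF E S])
  finally have Rs: "Rs M = placement_of_cover d S ` F'" .
  have "finite {f \<in> sources d S \<rightarrow>\<^sub>E UNIV.
      (\<Sum>h\<in>sources d S. replicate_mset (?w h) (X (f h))) = M}"
    by (rule finite_injections_with_content [OF X fin w])
  then have "finite F'"
    by (rule rev_finite_subset) (auto simp: F'_def F_def)
  then show "finite (Rs M)" by (simp add: Rs)
  have "inj_on (placement_of_cover d S) F'"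
    using bij by (auto simp: bij_betw_def F'_def intro: inj_on_subset)
  then have "card (Rs M) = card F'" by (simp add: Rs card_image)
  then show "coeff (aug_monomial_sym X (partition_type (cover_paths d S))) M = int (card (Rs M))"
  proof -
    have "aug_monomial_sym X (image_mset ?w (mset_set (sources d S))) =
        formal_sum (\<lambda>f. monom (\<Sum>h\<in>sources d S. replicate_mset (?w h) (X (f h)))) F"
      unfolding F_def by (rule aug_monomial_sym_eq_sum_over_injections [OF X fin w])
    then have "coeff (aug_monomial_sym X (partition_type (cover_paths d S))) M = int (card F')"
      by (simp only: partition_type_cover_paths [OF S'] coeff_formal_sum_monom F'_def)
    with \<open>card (Rs M) = card F'\<close> show ?thesis by simp
  qed
qed

theorem proposition18:
  fixes d :: nat and E :: "(nat \<times> nat) set"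
  assumes "E \<subseteq> {1..d} \<times> {1..d}"
    and "acyclic E"
  shows "path_cycle_sf d E =
    (\<Sum>P | partition_on {1..d} P.
       of_int (partition_moebius {1..d} (singletons {1..d}) P) * T_ge d E P)"
proof -
  have "path_cycle_sf d E = T_eq d E (singletons {1..d})"
  proof (rule series_eqI)
    fix M
    let ?Rs = "\<lambda>S. {R \<in> placements d E. inj_on fst R \<and> original_rooks R = S \<and> color_content d R = M}"
    have "finite E" using assms(1) by (rule finite_subset) simp
    then have "finite (Pow E)" by simp
    then have fin: "finite (path_cycle_covers E)"
      by (rule rev_finite_subset) (auto simp: path_cycle_covers_def)
    have "acyclic S" if "S \<in> path_cycle_covers E" for S
      using that assms(2) acyclic_subset [of E S] by (simp add: path_cycle_covers_def)
    then have "path_cycle_sf d E =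
        (\<Sum>S\<in>path_cycle_covers E. aug_monomial_sym X (partition_type (cover_paths d S)))"
      unfolding path_cycle_sf_def
      by (intro sum.cong) (auto simp: cover_cycles_acyclic partition_type_def power_sum_sym_def)
    then have "coeff (path_cycle_sf d E) M = int (\<Sum>S\<in>path_cycle_covers E. card (?Rs S))"
      unfolding of_nat_sum by (simp only: coeff_sum coeff_cover_term(2) [OF assms] cong: sum.cong)
    also have "(\<Sum>S\<in>path_cycle_covers E. card (?Rs S)) = card (\<Union>S\<in>path_cycle_covers E. ?Rs S)"
    proof (rule card_UN_disjoint [symmetric, OF fin])
      show "\<forall>S\<in>path_cycle_covers E. finite (?Rs S)"
        using coeff_cover_term(1) [OF assms] by blast
    qed blast
    also have "(\<Union>S\<in>path_cycle_covers E. ?Rs S) =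
        {R \<in> placements d E. inj_on fst R \<and> color_content d R = M}"
      using original_rooks_cover by blast
    finally show "coeff (path_cycle_sf d E) M = coeff (T_eq d E (singletons {1..d})) M"
      by (simp only: coeff_T_eq_singletons [OF assms(1)])
  qed
  then show ?thesis by (simp only: sum_partition_moebius_T_ge)
qed

end
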